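(* Let $p\ge2$ be an integer, $a,b>0$, $x_0\in\mathbb{R}^p$, $q\in\{1,2,\infty\}$, $h>0$, and let $\mathcal{A}_q$, $\mathcal{B}$ and the simultaneous random perturbation estimator $S_n$ be as defined in the context. Then for any even $n\ge2$, $$\sup_{f\in\mathcal{A}_q,\ \sigma^2\in\mathcal{B}}E\|S_n-\nabla f(x_0)\|_2^2=\infty .$$
   Context: Setting. $f:\mathbb{R}^p\to\mathbb{R}$ is an unknown function; for any chosen $x\in\mathbb{R}^p$ one can observe a random variable $Y(x)$ with $E[Y(x)]=f(x)$ and $Var(Y(x))=\sigma^2(x)$. The goal is to estimate $\nabla f(x_0)$. Problem classes, for given constants $a,b>0$: $\mathcal{A}_q$ is the set of functions $f:\mathbb{R}^p\to\mathbb{R}$ such that $\nabla^2f(x_0)$ exists and, for all $x\in\mathbb{R}^p$, $$\left|f(x)-f(x_0)-\nabla f(x_0)^T(x-x_0)-\tfrac12(x-x_0)^T\nabla^2f(x_0)(x-x_0)\right|\le\tfrac a6\|x-x_0\|_q^3,$$ with $\|\cdot\|_q$ the $\ell_q$-norm. $\mathcal{B}$ is the set of variance functions $\sigma^2(\cdot)$ on $\mathbb{R}^p$ with $\sigma^2(x)\le b$ for all $x$. Random perturbation estimator. Let $\delta=(\delta^1,\dots,\delta^p)$ be a random vector in $\mathbb{R}^p$ whose components $\delta^i$ are i.i.d., symmetrically distributed about $0$, and satisfy some additional properties, namely those customary for simultaneous perturbation as described, e.g., in J. C. Spall's 1992 work on multivariate stochastic approximation by simultaneous perturbation (their exact form is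 not specified and is not used in the result). Let $\phi(\delta)=(1/\delta^1,\dots,1/\delta^p)^T$. For $n$ even and a scaling parameter $h>0$, repeatedly and independently simulate copies $\delta_1,\dots,\delta_{n/2}\in\mathbb{R}^p$ of $\delta$ and the outputs $Y_j(\cdot)$ (given the $\delta_j$, the outputs are independent, with $Y_{2j-1}(x_0+h\delta_j)$ and $Y_{2j}(x_0-h\delta_j)$ having means $f(x_0\pm h\delta_j)$ and variances $\sigma^2(x_0\pm h\delta_j)$ respectively), and set $$S_n=\frac{1}{n/2}\sum_{j=1}^{n/2}\frac{Y_{2j-1}(x_0+h\delta_j)-Y_{2j}(x_0-h\delta_j)}{2h}\,\phi(\delta_j).$$ The expectation is over both the perturbations and the simulation noise. *)

theory Defs
  imports "HOL-Probability.Probability"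
begin

definition lq_norm :: "ereal \<Rightarrow> real ^ 'n \<Rightarrow> real" where
  "lq_norm q v =
    (if q = \<infinity> then Max (range (\<lambda>i. \<bar>v $ i\<bar>))
     else (\<Sum>i\<in>UNIV. \<bar>v $ i\<bar> powr real_of_ereal q) powr (1 / real_of_ereal q))"

definition gradient :: "(real ^ 'n \<Rightarrow> real) \<Rightarrow> real ^ 'n \<Rightarrow> real ^ 'n" where
  "gradient f x = (THE D. GDERIV f x :> D)"

text \<open>Existence of the Hessian is read as twice (Frechet) differentiability at the point:
  the gradient exists on a neighbourhood of \<open>x\<close> and is itself differentiable at \<open>x\<close>.\<close>

definition has_hessian :: "(real ^ 'n \<Rightarrow> real) \<Rightarrow> real ^ 'n \<Rightarrow> real ^ 'n ^ 'n \<Rightarrow> bool" where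
  "has_hessian f x H \<longleftrightarrow>
    (\<exists>g. (\<forall>\<^sub>F y in nhds x. GDERIV f y :> g y) \<and> (g has_derivative (\<lambda>v. H *v v)) (at x))"

definition hessian :: "(real ^ 'n \<Rightarrow> real) \<Rightarrow> real ^ 'n \<Rightarrow> real ^ 'n ^ 'n" where
  "hessian f x = (THE H. has_hessian f x H)"

definition func_class :: "ereal \<Rightarrow> real \<Rightarrow> real ^ 'n \<Rightarrow> (real ^ 'n \<Rightarrow> real) set" where
  "func_class q a x0 =
    {f. (\<exists>H. has_hessian f x0 H) \<and>
        (\<forall>x. \<bar>f x - f x0 - gradient f x0 \<bullet> (x - x0)
                - 1 / 2 * ((x - x0) \<bullet> (hessian f x0 *v (x - x0)))\<bar>
              \<le> a / 6 * lq_norm q (x - x0) ^ 3)}"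

definition var_class :: "real \<Rightarrow> (real ^ 'n \<Rightarrow> real) set" where
  "var_class b = {s. \<forall>x. 0 \<le> s x \<and> s x \<le> b}"

text \<open>\<open>Q x\<close> is the law of the output \<open>Y(x)\<close>. It is a Markov kernel, so that an output may be
  observed at a random point; this forces \<open>f\<close> and \<open>s\<close> to be Borel measurable.\<close>

definition observation_kernel ::
    "(real ^ 'n \<Rightarrow> real) \<Rightarrow> (real ^ 'n \<Rightarrow> real) \<Rightarrow> (real ^ 'n \<Rightarrow> real measure) \<Rightarrow> bool" where
  "observation_kernel f s Q \<longleftrightarrow>
    Q \<in> borel \<rightarrow>\<^sub>M prob_algebra borel \<and>
    (\<forall>x. integrable (Q x) (\<lambda>y. y\<^sup>2) \<and>
         prob_space.expectation (Q x) (\<lambda>y. y) = f x \<and>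
         prob_space.variance (Q x) (\<lambda>y. y) = s x)"

text \<open>Law of a perturbation vector with i.i.d. components that are symmetric about \<open>0\<close>. The
  components are almost surely nonzero, so that their reciprocals make sense.\<close>

definition perturbation_law :: "(real ^ 'n) measure \<Rightarrow> bool" where
  "perturbation_law D \<longleftrightarrow>
    prob_space D \<and> sets D = sets borel \<and>
    prob_space.indep_vars D (\<lambda>_. borel) (\<lambda>i d. d $ i) UNIV \<and>
    (\<forall>i k. distr D borel (\<lambda>d. d $ i) = distr D borel (\<lambda>d. d $ k)) \<and>
    (\<forall>i. distr D borel (\<lambda>d. - (d $ i)) = distr D borel (\<lambda>d. d $ i)) \<and>
    (\<forall>i. AE d in D. d $ i \<noteq> 0)"

text \<open>Joint law of one replication: the perturbation \<open>d\<close> and, given \<open>d\<close>, two independent outputs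
  at \<open>x0 + h d\<close> and \<open>x0 - h d\<close>.\<close>

definition replication_law ::
    "(real ^ 'n) measure \<Rightarrow> (real ^ 'n \<Rightarrow> real measure) \<Rightarrow> real ^ 'n \<Rightarrow> real
      \<Rightarrow> ((real ^ 'n) \<times> real \<times> real) measure" where
  "replication_law D Q x0 h =
    D \<bind> (\<lambda>d. return borel d \<Otimes>\<^sub>M (Q (x0 + h *\<^sub>R d) \<Otimes>\<^sub>M Q (x0 - h *\<^sub>R d)))"

text \<open>The \<open>j\<close>-th component of a sample point is the triple of the \<open>j\<close>-th perturbation and the
  outputs numbered \<open>2j - 1\<close> and \<open>2j\<close>. Independence of the triples makes all \<open>n\<close> outputs
  independent given the perturbations.\<close>

definition simulation_law ::
    "(real ^ 'n) measure \<Rightarrow> (real ^ 'n \<Rightarrow> real measure) \<Rightarrow> real ^ 'n \<Rightarrow> real \<Rightarrow> nat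
      \<Rightarrow> (nat \<Rightarrow> (real ^ 'n) \<times> real \<times> real) measure" where
  "simulation_law D Q x0 h n = (\<Pi>\<^sub>M j\<in>{1..n div 2}. replication_law D Q x0 h)"

definition reciprocals :: "real ^ 'n \<Rightarrow> real ^ 'n" where
  "reciprocals d = (\<chi> i. 1 / d $ i)"

definition sp_estimator :: "real \<Rightarrow> nat \<Rightarrow> (nat \<Rightarrow> (real ^ 'n) \<times> real \<times> real) \<Rightarrow> real ^ 'n" where
  "sp_estimator h n \<omega> =
    (1 / (real n / 2)) *\<^sub>R
      (\<Sum>j = 1..n div 2. case \<omega> j of (d, yp, ym) \<Rightarrow> ((yp - ym) / (2 * h)) *\<^sub>R reciprocals d)"

definition sp_mse ::
    "(real ^ 'n) measure \<Rightarrow> (real ^ 'n \<Rightarrow> real measure) \<Rightarrow> real ^ 'n \<Rightarrow> real \<Rightarrow> nat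
      \<Rightarrow> (real ^ 'n \<Rightarrow> real) \<Rightarrow> ennreal" where
  "sp_mse D Q x0 h n f =
    (\<integral>\<^sup>+ \<omega>. ennreal ((norm (sp_estimator h n \<omega> - gradient f x0))\<^sup>2) \<partial>simulation_law D Q x0 h n)"

end

theory Submission
  imports Defs
begin

text \<open>Take noiseless linear functions \<open>f y = c y\<^sub>i\<close>. They lie in every class, however large \<open>c\<close> is,
  but for \<open>k \<noteq> i\<close> the \<open>k\<close>-th component of the estimator is \<open>c\<close> times the average of the
  ratios \<open>\<delta>\<^sub>i / \<delta>\<^sub>k\<close>, while the \<open>k\<close>-th component of the gradient is \<open>0\<close>. The ratios are symmetric
  and independent across replications, so the mean square of this average is bounded below by a
  fixed positive multiple of \<open>c\<^sup>2\<close>.\<close>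

section \<open>Point masses and zero variance\<close>

lemma return_pair_measure:
  assumes x: "x \<in> space M" and y: "y \<in> space N"
  shows "return M x \<Otimes>\<^sub>M return N y = return (M \<Otimes>\<^sub>M N) (x, y)"
proof (rule pair_measure_eqI)
  interpret x: prob_space "return M x" by (rule prob_space_return[OF x])
  interpret y: prob_space "return N y" by (rule prob_space_return[OF y])
  show "sigma_finite_measure (return M x)" "sigma_finite_measure (return N y)"
    by unfold_locales
  show "sets (return M x \<Otimes>\<^sub>M return N y) = sets (return (M \<Otimes>\<^sub>M N) (x, y))"
    by (simp cong: sets_pair_measure_cong)
  fix A B assume "A \<in> sets (return M x)" "B \<in> sets (return N y)"
  then show "emeasure (return M x) A * emeasure (return N y) B =
      emeasure (return (M \<Otimes>\<^sub>M N) (x, y)) (A \<times> B)"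
    by (auto simp: indicator_def)
qed

text \<open>The squared deviation from the mean is nonnegative with integral zero, so it vanishes
  almost everywhere and the identity is almost surely constant.\<close>

lemma prob_measure_eq_return_if_variance_eq_0:
  fixes M :: "real measure"
  assumes "prob_space M" and sets: "sets M = sets borel" and sq: "integrable M (\<lambda>y. y\<^sup>2)"
    and var: "prob_space.variance M (\<lambda>y. y) = 0"
  shows "M = return borel (prob_space.expectation M (\<lambda>y. y))"
proof -
  interpret prob_space M by fact
  have [measurable]: "(\<lambda>y. y) \<in> borel_measurable M"
    by (simp add: measurable_ident_sets sets)
  have int: "integrable M (\<lambda>y. y)"
    by (rule square_integrable_imp_integrable) (use sq in auto)
  have "integrable M (\<lambda>y. (y - expectation (\<lambda>y. y))\<^sup>2)"
    using sq int by (simp add: power2_diff)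
  with var have "AE y in M. y = expectation (\<lambda>y. y)"
    by (subst (asm) integral_nonneg_eq_0_iff_AE) auto
  from AE_eq_constD(1)[OF this] show ?thesis
    using return_cong[OF sets] by simp
qed

section \<open>Second moments of symmetric random variables\<close>

text \<open>Symmetry lets \<open>Z\<close> be replaced by \<open>- Z\<close> on the right. Averaging
  both versions cancels the cross term and leaves Z^2 + r^2. Working with nonnegative integrals
  covers variables with infinite second moment or without a mean.\<close>

lemma nn_integral_square_le_shift_symmetric:
  fixes Z :: "'a \<Rightarrow> real"
  assumes Z[measurable]: "Z \<in> borel_measurable M"
    and symmetric: "distr M borel (\<lambda>x. - Z x) = distr M borel Z"
  shows "(\<integral>\<^sup>+x. ennreal ((Z x)\<^sup>2) \<partial>M) \<le> (\<integral>\<^sup>+x. ennreal ((Z x + r)\<^sup>2) \<partial>M)"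
proof -
  have "(\<integral>\<^sup>+x. ennreal ((- Z x + r)\<^sup>2) \<partial>M) =
      (\<integral>\<^sup>+z. ennreal ((z + r)\<^sup>2) \<partial>distr M borel (\<lambda>x. - Z x))"
    by (subst nn_integral_distr) auto
  also have "\<dots> = (\<integral>\<^sup>+x. ennreal ((Z x + r)\<^sup>2) \<partial>M)"
    unfolding symmetric by (subst nn_integral_distr) auto
  finally have flip: "(\<integral>\<^sup>+x. ennreal ((- Z x + r)\<^sup>2) \<partial>M) = (\<integral>\<^sup>+x. ennreal ((Z x + r)\<^sup>2) \<partial>M)" .
  have "2 * (\<integral>\<^sup>+x. ennreal ((Z x)\<^sup>2) \<partial>M) = (\<integral>\<^sup>+x. 2 * ennreal ((Z x)\<^sup>2) \<partial>M)"
    by (subst nn_integral_cmult) auto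
  also have "\<dots> \<le> (\<integral>\<^sup>+x. ennreal ((Z x + r)\<^sup>2) + ennreal ((- Z x + r)\<^sup>2) \<partial>M)"
  proof (rule nn_integral_mono)
    fix x
    have "2 * (Z x)\<^sup>2 \<le> (Z x + r)\<^sup>2 + (- Z x + r)\<^sup>2"
      by (simp add: power2_eq_square algebra_simps)
    then have "ennreal (2 * (Z x)\<^sup>2) \<le> ennreal ((Z x + r)\<^sup>2 + (- Z x + r)\<^sup>2)"
      by (rule ennreal_leI)
    then show "2 * ennreal ((Z x)\<^sup>2) \<le> ennreal ((Z x + r)\<^sup>2) + ennreal ((- Z x + r)\<^sup>2)"
      by (simp add: ennreal_mult)
  qed
  also have "\<dots> = 2 * (\<integral>\<^sup>+x. ennreal ((Z x + r)\<^sup>2) \<partial>M)"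
    by (subst nn_integral_add) (auto simp: flip[simplified] mult_2)
  finally show ?thesis
    by (simp add: ennreal_mult_le_mult_iff)
qed

text \<open>Freeze all coordinates but \<open>i\<close>: the sum of the others is then a constant
  shift, and the previous bound applies to the inner integral over coordinate
  \<open>i\<close>.\<close>

lemma nn_integral_square_le_PiM_sum_symmetric:
  fixes Z :: "'a \<Rightarrow> real"
  assumes R: "prob_space R" and Z[measurable]: "Z \<in> borel_measurable R"
    and symmetric: "distr R borel (\<lambda>x. - Z x) = distr R borel Z"
    and J: "finite J" "i \<in> J"
  shows "(\<integral>\<^sup>+x. ennreal ((Z x)\<^sup>2) \<partial>R) \<le>
    (\<integral>\<^sup>+\<omega>. ennreal ((\<Sum>j\<in>J. Z (\<omega> j))\<^sup>2) \<partial>(\<Pi>\<^sub>M j\<in>J. R))"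
proof -
  interpret R: prob_space R by fact
  interpret product_prob_space "\<lambda>_. R" by unfold_locales
  interpret PK: prob_space "\<Pi>\<^sub>M j\<in>J - {i}. R" by (rule prob_space_PiM) (rule R)
  let ?K = "J - {i}"
  have J': "J = insert i ?K" "finite ?K" "i \<notin> ?K"
    using J by auto
  have [measurable]: "(\<lambda>\<omega>. \<Sum>j\<in>J. Z (\<omega> j)) \<in> borel_measurable (\<Pi>\<^sub>M j\<in>J. R)"
    by measurable
  have "(\<integral>\<^sup>+x. ennreal ((Z x)\<^sup>2) \<partial>R) =
      (\<integral>\<^sup>+\<omega>. (\<integral>\<^sup>+x. ennreal ((Z x)\<^sup>2) \<partial>R) \<partial>(\<Pi>\<^sub>M j\<in>?K. R))"
    by (simp add: PK.emeasure_space_1)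
  also have "\<dots> \<le> (\<integral>\<^sup>+\<omega>. (\<integral>\<^sup>+x. ennreal ((Z x + (\<Sum>j\<in>?K. Z (\<omega> j)))\<^sup>2) \<partial>R) \<partial>(\<Pi>\<^sub>M j\<in>?K. R))"
    by (intro nn_integral_mono nn_integral_square_le_shift_symmetric Z symmetric)
  also have "\<dots> = (\<integral>\<^sup>+\<omega>. (\<integral>\<^sup>+x. ennreal ((\<Sum>j\<in>J. Z (fun_upd \<omega> i x j))\<^sup>2) \<partial>R) \<partial>(\<Pi>\<^sub>M j\<in>?K. R))"
    using J by (simp add: sum.remove[of J i])
  also have "\<dots> = (\<integral>\<^sup>+\<omega>. ennreal ((\<Sum>j\<in>J. Z (\<omega> j))\<^sup>2) \<partial>(\<Pi>\<^sub>M j\<in>J. R))"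
    using product_nn_integral_insert[OF J'(2,3), of "\<lambda>\<omega>. ennreal ((\<Sum>j\<in>J. Z (\<omega> j))\<^sup>2)"]
    unfolding J'(1)[symmetric] by simp
  finally show ?thesis .
qed

section \<open>Linear functions as members of the function class\<close>

lemma lq_norm_nonneg: "0 \<le> lq_norm q v"
proof -
  have "0 \<le> Max (range (\<lambda>i. \<bar>v $ i\<bar>))"
    by (rule order_trans[OF abs_ge_zero]) (rule Max_ge, auto)
  then show ?thesis by (simp add: lq_norm_def)
qed

lemma GDERIV_inner_left: "GDERIV (\<lambda>x. v \<bullet> x) x :> v"
  unfolding gderiv_def by (auto intro!: derivative_eq_intros simp: inner_commute)

lemma GDERIV_unique:
  assumes "GDERIV f x :> D" "GDERIV f x :> E"
  shows "D = E"
proof -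
  have "(\<lambda>h. h \<bullet> D) = (\<lambda>h. h \<bullet> E)"
    using assms unfolding gderiv_def by (rule has_derivative_unique)
  then show ?thesis by (metis inner_commute vector_eq_rdot)
qed

lemma gradient_eqI: "GDERIV f x :> D \<Longrightarrow> gradient f x = D"
  unfolding gradient_def by (blast intro: GDERIV_unique)

text \<open>The equivalence yields existence and uniqueness at once; both are needed to evaluate the
  definite description in \<open>hessian\<close>.\<close>

lemma has_hessian_inner_iff:
  fixes v :: "real ^ 'n"
  shows "has_hessian (\<lambda>y. v \<bullet> y) x H \<longleftrightarrow> H = 0"
proof
  assume "has_hessian (\<lambda>y. v \<bullet> y) x H"
  then obtain g where g: "\<forall>\<^sub>F y in nhds x. GDERIV (\<lambda>y. v \<bullet> y) y :> g y"
    and g': "(g has_derivative (\<lambda>u. H *v u)) (at x)"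
    by (auto simp: has_hessian_def)
  have ev: "\<forall>\<^sub>F y in nhds x. g y = v"
    using g by eventually_elim (rule GDERIV_unique[OF _ GDERIV_inner_left])
  \<comment> \<open>Near \<open>x\<close>, and at \<open>x\<close> itself, \<open>g\<close> is the
    constant \<open>v\<close>, so the derivative of \<open>g\<close> carries over to the constant
    map.\<close>
  have "((\<lambda>_. v) has_derivative (\<lambda>u. H *v u)) (at x)"
    by (rule has_derivative_transform_eventually[OF g'])
       (use ev eventually_nhds_x_imp_x[OF ev] in \<open>auto simp: eventually_at_filter elim: eventually_mono\<close>)
  then have "(\<lambda>u. H *v u) = (\<lambda>u. 0)"
    by (rule has_derivative_unique) simp
  then show "H = 0"
    by (metis matrix_eq matrix_vector_mult_0)
next
  have "(*v) (0 :: real ^ 'n ^ 'n) = (\<lambda>_. 0)"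
    by (simp add: fun_eq_iff)
  moreover assume "H = 0"
  ultimately show "has_hessian (\<lambda>y. v \<bullet> y) x H"
    unfolding has_hessian_def
    by (intro exI[of _ "\<lambda>_. v"]) (auto simp: GDERIV_inner_left[unfolded gderiv_def] gderiv_def)
qed

lemma hessian_inner: "hessian (\<lambda>y. v \<bullet> y) x = 0"
  unfolding hessian_def by (rule the_equality) (simp_all add: has_hessian_inner_iff)

text \<open>The second-order Taylor remainder of a linear function is identically zero, so the size
  of \<open>v\<close> is unrestricted.\<close>

lemma inner_in_func_class:
  assumes "a > 0"
  shows "(\<lambda>y. v \<bullet> y) \<in> func_class q a x0"
  using assms lq_norm_nonneg[of q]
  by (auto simp: func_class_def hessian_inner has_hessian_inner_iff
      gradient_eqI[OF GDERIV_inner_left] inner_diff_right intro!: mult_nonneg_nonneg)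

section \<open>Noiseless observations\<close>

text \<open>A kernel is prescribed only through mean and variance; with zero variance these
  determine it completely, so any admissible choice of \<open>Q\<close> can be handled.\<close>

lemma observation_kernel_noiseless:
  assumes "observation_kernel f (\<lambda>_. 0) Q"
  shows "Q x = return borel (f x)"
proof -
  have Q: "Q \<in> borel \<rightarrow>\<^sub>M prob_algebra borel" and m: "integrable (Q x) (\<lambda>y. y\<^sup>2)"
    "prob_space.expectation (Q x) (\<lambda>y. y) = f x" "prob_space.variance (Q x) (\<lambda>y. y) = 0"
    using assms unfolding observation_kernel_def by blast+
  have "Q x \<in> space (prob_algebra borel)"
    using measurable_space[OF Q] by simp
  then have "prob_space (Q x)" "sets (Q x) = sets borel"
    by (auto simp: space_prob_algebra)
  from prob_measure_eq_return_if_variance_eq_0[OF this m(1,3)] show ?thesis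
    by (simp add: m(2))
qed

text \<open>Once both outputs are point masses, the perturbation is the only randomness left, and
  binding with a point mass is a push-forward.\<close>

lemma replication_law_noiseless:
  assumes D: "perturbation_law D" and [measurable]: "f \<in> borel_measurable borel"
    and Q: "observation_kernel f (\<lambda>_. 0) Q"
  shows "replication_law D Q x0 h =
    distr D (borel \<Otimes>\<^sub>M (borel \<Otimes>\<^sub>M borel)) (\<lambda>d. (d, f (x0 + h *\<^sub>R d), f (x0 - h *\<^sub>R d)))"
proof -
  interpret prob_space D using D by (simp add: perturbation_law_def)
  have [measurable_cong]: "sets D = sets borel" using D by (simp add: perturbation_law_def)
  have "replication_law D Q x0 h =
      D \<bind> (\<lambda>d. return (borel \<Otimes>\<^sub>M (borel \<Otimes>\<^sub>M borel)) (d, f (x0 + h *\<^sub>R d), f (x0 - h *\<^sub>R d)))"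
    by (simp add: replication_law_def observation_kernel_noiseless[OF Q] return_pair_measure
        space_pair_measure)
  also have "\<dots> = distr D (borel \<Otimes>\<^sub>M (borel \<Otimes>\<^sub>M borel))
      (\<lambda>d. (d, f (x0 + h *\<^sub>R d), f (x0 - h *\<^sub>R d)))"
    by (rule bind_return_distr') (use not_empty in auto)
  finally show ?thesis .
qed

section \<open>Ratios of perturbation components\<close>

text \<open>By independence the joint law of components \<open>i\<close> and \<open>k\<close> is the
  product of the marginals, so flipping the sign of component \<open>i\<close> alone preserves it.
  For \<open>i = k\<close> the ratio would be almost surely 1.\<close>

lemma perturbation_ratio_symmetric:
  assumes D: "perturbation_law D" and ik: "i \<noteq> k"
  shows "distr D borel (\<lambda>d. - (c * (d $ i / d $ k))) = distr D borel (\<lambda>d. c * (d $ i / d $ k))"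
proof -
  interpret prob_space D using D by (simp add: perturbation_law_def)
  have [measurable_cong]: "sets D = sets borel" using D by (simp add: perturbation_law_def)
  have "indep_vars (\<lambda>_. borel) (\<lambda>i d. d $ i) UNIV"
    using D by (simp add: perturbation_law_def)
  then have "indep_vars (\<lambda>_. borel) (\<lambda>i d. d $ i) (insert i {k})"
    by (rule indep_vars_subset) simp
  \<comment> \<open>The sum over a singleton serves to extract a pair of independent variables from
    the family.\<close>
  then have "indep_var borel (\<lambda>d. d $ i) borel (\<lambda>d. \<Sum>j\<in>{k}. d $ j)"
    using ik by (intro indep_vars_sum) auto
  then have ind: "indep_var borel (\<lambda>d. d $ i) borel (\<lambda>d. d $ k)"
    by simp
  then have "indep_var borel (uminus \<circ> (\<lambda>d. d $ i)) borel (id \<circ> (\<lambda>d. d $ k))"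
    by (rule indep_var_compose) auto
  then have ind': "indep_var borel (\<lambda>d. - d $ i) borel (\<lambda>d. d $ k)"
    by (simp add: comp_def)
  have pair: "distr D (borel \<Otimes>\<^sub>M borel) (\<lambda>d. (- d $ i, d $ k)) =
      distr D (borel \<Otimes>\<^sub>M borel) (\<lambda>d. (d $ i, d $ k))"
    using ind ind' D unfolding indep_var_distribution_eq perturbation_law_def by metis
  have "distr D borel (\<lambda>d. - (c * (d $ i / d $ k))) =
      distr (distr D (borel \<Otimes>\<^sub>M borel) (\<lambda>d. (- d $ i, d $ k))) borel (\<lambda>(u, v). c * (u / v))"
    by (subst distr_distr) (auto simp: comp_def)
  also have "\<dots> = distr D borel (\<lambda>d. c * (d $ i / d $ k))"
    unfolding pair by (subst distr_distr) (auto simp: comp_def)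
  finally show ?thesis .
qed

text \<open>Components are almost surely nonzero, so the integrand is almost surely positive. The
  integral may be infinite.\<close>

lemma perturbation_ratio_pos:
  assumes D: "perturbation_law D"
  shows "0 < (\<integral>\<^sup>+d. ennreal ((d $ i / d $ k)\<^sup>2) \<partial>D)"
proof -
  interpret prob_space D using D by (simp add: perturbation_law_def)
  have [measurable_cong]: "sets D = sets borel" using D by (simp add: perturbation_law_def)
  have nz: "AE d in D. d $ i \<noteq> 0" "AE d in D. d $ k \<noteq> 0"
    using D by (auto simp: perturbation_law_def)
  have "\<not> (AE d in D. ennreal ((d $ i / d $ k)\<^sup>2) = 0)"
  proof
    assume "AE d in D. ennreal ((d $ i / d $ k)\<^sup>2) = 0"
    with nz have "AE d in D. False"
      by eventually_elim simp
    then show False by simp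
  qed
  then have "(\<integral>\<^sup>+d. ennreal ((d $ i / d $ k)\<^sup>2) \<partial>D) \<noteq> 0"
    by (subst nn_integral_0_iff_AE) auto
  then show ?thesis by (simp add: zero_less_iff_neq_zero)
qed

section \<open>Lower bound for the mean squared error and its divergence\<close>

text \<open>Only component \<open>k\<close> of the error is kept. There the gradient vanishes, and
  the estimator is a sum of independent symmetric terms, whose second moment is at least that of a
  single term.\<close>

lemma sp_mse_linear_noiseless_ge:
  fixes x0 :: "real ^ 'p"
  assumes D: "perturbation_law D" and ik: "i \<noteq> k" and h: "h > 0" and n: "even n" "n \<ge> 2"
    and Q: "observation_kernel (\<lambda>y. axis i c \<bullet> y) (\<lambda>_. 0) Q"
  shows "ennreal ((c / (real n / 2))\<^sup>2) * (\<integral>\<^sup>+d. ennreal ((d $ i / d $ k)\<^sup>2) \<partial>D)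
    \<le> sp_mse D Q x0 h n (\<lambda>y. axis i c \<bullet> y)"
proof -
  interpret D: prob_space D using D by (simp add: perturbation_law_def)
  have [measurable_cong]: "sets D = sets borel" using D by (simp add: perturbation_law_def)
  define m where "m = real n / 2"
  define T where "T d = (d, axis i c \<bullet> (x0 + h *\<^sub>R d), axis i c \<bullet> (x0 - h *\<^sub>R d))" for d
  define R where "R = distr D (borel \<Otimes>\<^sub>M (borel \<Otimes>\<^sub>M borel)) T"
  \<comment> \<open>\<open>Z\<close> is the contribution of one replication to component
    \<open>k\<close> of the estimator, with the averaging factor 1 / \<open>m\<close>
    included.\<close>
  define Z :: "(real ^ 'p) \<times> real \<times> real \<Rightarrow> real"
    where "Z = (\<lambda>x. (fst (snd x) - snd (snd x)) / (2 * h) * (1 / fst x $ k) / m)"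
  have T[measurable]: "T \<in> D \<rightarrow>\<^sub>M (borel \<Otimes>\<^sub>M (borel \<Otimes>\<^sub>M borel))"
    unfolding T_def by measurable
  have R: "prob_space R"
    unfolding R_def by (rule D.prob_space_distr) measurable
  have [measurable_cong]: "sets R = sets (borel \<Otimes>\<^sub>M (borel \<Otimes>\<^sub>M borel))"
    by (simp add: R_def)
  have rep: "replication_law D Q x0 h = R"
    unfolding R_def T_def by (rule replication_law_noiseless[OF D _ Q]) measurable
  have Z[measurable]: "Z \<in> borel_measurable (borel \<Otimes>\<^sub>M (borel \<Otimes>\<^sub>M borel))"
    unfolding Z_def
    by (intro borel_measurable_times borel_measurable_divide borel_measurable_diff
        borel_measurable_const measurable_compose[OF measurable_fst]) measurable
  \<comment> \<open>Linearity makes \<open>x0\<close> and \<open>h\<close> cancel from the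
    difference quotient.\<close>
  have ZT: "Z (T d) = c / m * (d $ i / d $ k)" for d
  proof -
    have "fst (snd (T d)) - snd (snd (T d)) = c * d $ i * (2 * h)"
      by (simp add: T_def inner_axis' algebra_simps)
    with h show ?thesis
      by (simp add: Z_def) (simp add: T_def)
  qed
  have symmetric: "distr R borel (\<lambda>x. - Z x) = distr R borel Z"
    using perturbation_ratio_symmetric[OF D ik, of "c / m"]
    by (simp add: R_def distr_distr comp_def ZT)
  have "ennreal ((c / m)\<^sup>2) * (\<integral>\<^sup>+d. ennreal ((d $ i / d $ k)\<^sup>2) \<partial>D) =
      (\<integral>\<^sup>+d. ennreal ((Z (T d))\<^sup>2) \<partial>D)"
    unfolding ZT power_mult_distrib[of "c / m"]
    by (subst nn_integral_cmult[symmetric]) (auto simp: ennreal_mult)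
  also have "\<dots> = (\<integral>\<^sup>+x. ennreal ((Z x)\<^sup>2) \<partial>R)"
    unfolding R_def by (subst nn_integral_distr) auto
  also have "\<dots> \<le> (\<integral>\<^sup>+\<omega>. ennreal ((\<Sum>j\<in>{1..n div 2}. Z (\<omega> j))\<^sup>2) \<partial>(\<Pi>\<^sub>M j\<in>{1..n div 2}. R))"
    \<comment> \<open>Any index would do; 1 lies in the index set because \<open>n\<close> is at
      least 2.\<close>
    by (rule nn_integral_square_le_PiM_sum_symmetric[OF R _ symmetric, where i = 1])
       (use n in auto)
  also have "\<dots> \<le> sp_mse D Q x0 h n (\<lambda>y. axis i c \<bullet> y)"
    unfolding sp_mse_def simulation_law_def rep
  proof (intro nn_integral_mono ennreal_leI)
    fix \<omega> :: "nat \<Rightarrow> (real ^ 'p) \<times> real \<times> real"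
    have "(sp_estimator h n \<omega> - gradient (\<lambda>y. axis i c \<bullet> y) x0) $ k = (\<Sum>j\<in>{1..n div 2}. Z (\<omega> j))"
      using ik by (auto simp: sp_estimator_def gradient_eqI[OF GDERIV_inner_left] axis_def Z_def
          m_def[symmetric] reciprocals_def sum_divide_distrib split_beta intro!: sum.cong)
    then show "(\<Sum>j\<in>{1..n div 2}. Z (\<omega> j))\<^sup>2 \<le>
        (norm (sp_estimator h n \<omega> - gradient (\<lambda>y. axis i c \<bullet> y) x0))\<^sup>2"
      by (metis component_le_norm_cart abs_le_square_iff abs_norm_cancel)
  qed
  finally show ?thesis by (simp add: m_def)
qed

theorem theorem3:
  fixes x0 :: "real ^ 'p" and a b h :: real and q :: ereal and n :: nat
    and D :: "(real ^ 'p) measure"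
    and Q :: "(real ^ 'p \<Rightarrow> real) \<Rightarrow> (real ^ 'p \<Rightarrow> real) \<Rightarrow> real ^ 'p \<Rightarrow> real measure"
  assumes "CARD('p) \<ge> 2" and "a > 0" and "b > 0" and "q \<in> {1, 2, \<infinity>}" and "h > 0"
    and "even n" and "n \<ge> 2"
    and "perturbation_law D"
    and "\<And>f s. f \<in> func_class q a x0 \<inter> borel_measurable borel \<Longrightarrow>
           s \<in> var_class b \<inter> borel_measurable borel \<Longrightarrow> observation_kernel f s (Q f s)"
  shows "(SUP f \<in> func_class q a x0 \<inter> borel_measurable borel.
            SUP s \<in> var_class b \<inter> borel_measurable borel.
              sp_mse D (Q f s) x0 h n f) = \<infinity>"
    (is "?S = \<infinity>")
proof -
  obtain i k :: 'p where ik: "i \<noteq> k"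
    using assms(1) by (meson card_2_iff' ex_card)
  define K where "K = (\<integral>\<^sup>+d. ennreal ((d $ i / d $ k)\<^sup>2) \<partial>D)"
  have K: "K \<noteq> 0"
    using perturbation_ratio_pos[OF assms(8), of i k] by (simp add: K_def)
  have le: "of_nat N * K \<le> ?S" for N :: nat
  proof -
    \<comment> \<open>Chosen so that the factor (\<open>c\<close> / (\<open>n\<close> / 2))^2 in the
      lower bound equals \<open>N\<close>.\<close>
    define c where "c = real n / 2 * sqrt (real N)"
    define f where "f = (\<lambda>y :: real ^ 'p. axis i c \<bullet> y)"
    have f: "f \<in> func_class q a x0 \<inter> borel_measurable borel"
      unfolding f_def using inner_in_func_class[OF assms(2)] by simp
    have s: "(\<lambda>_. 0) \<in> var_class b \<inter> borel_measurable borel"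
      using assms(3) by (simp add: var_class_def)
    have "of_nat N * K = ennreal ((c / (real n / 2))\<^sup>2) * K"
      using assms(7) by (simp add: c_def ennreal_of_nat_eq_real_of_nat)
    also have "\<dots> \<le> sp_mse D (Q f (\<lambda>_. 0)) x0 h n f"
      unfolding K_def f_def
      by (rule sp_mse_linear_noiseless_ge[OF assms(8) ik assms(5-7)])
         (rule assms(9)[OF f s, unfolded f_def])
    also have "\<dots> \<le> ?S"
      by (rule SUP_upper2[OF f]) (rule SUP_upper2[OF s order_refl])
    finally show ?thesis .
  qed
  \<comment> \<open>Since \<open>K\<close> is nonzero, possibly infinite, its multiples by naturals
    have supremum infinity.\<close>
  have "\<infinity> = (SUP N :: nat. of_nat N :: ennreal) * K"
    using K by (simp add: ennreal_SUP_of_nat_eq_top ennreal_top_mult)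
  also have "\<dots> = (SUP N :: nat. of_nat N * K)"
    by (rule SUP_mult_right_ennreal)
  also have "\<dots> \<le> ?S"
    by (intro SUP_least le)
  finally show ?thesis
    by (simp add: top.extremum_unique)
qed

end
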